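(* Let $m\ge 1$, $\Delta t>0$ and $u_h^{n-1}\in V_h$. Then the fully discrete semi-implicit log-density scheme in which the mass operator is evaluated by mass lumping is uniquely solvable: there exists exactly one $u_h^n\in V_h$ such that $$\mathcal{M}_h\left(\frac{\exp(u_h^n)-\exp(u_h^{n-1})}{\Delta t},v_h\right)+\mathcal{A}\left(m\exp(m u_h^{n-1});u_h^n,v_h\right)=0\qquad\text{for all } v_h\in V_h .$$
   Context: $\Omega\subset\mathbb{R}^d$, $d\in\{1,2,3\}$, is a bounded polyhedral domain, and $\Omega_h$ is a conforming simplicial triangulation of $\Omega$ with finitely many elements. For $K\in\Omega_h$, $\mathcal{V}_K$ denotes the set of vertices of $K$ and $|K|$ its volume. The finite element space is $V_h=\{v_h\in H^1(\Omega): v_h|_K\in P_1(K)\ \text{for all } K\in\Omega_h\}$, where $P_1(K)$ denotes the polynomials of degree at most one on $K$. The mass-lumped mass operator is $$\mathcal{M}_h(\alpha,\beta)=\sum_{K\in\Omega_h}\sum_{v\in\mathcal{V}_K}\frac{|K|}{d+1}\,\alpha(v)\,\beta(v),$$ and the stiffness operator is $$\mathcal{A}(\gamma;\alpha,\beta)=\int_\Omega \gamma\,\nabla\alpha\cdot\nabla\beta\,dx .$$ *)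

theory Defs
  imports "HOL-Analysis.Analysis"
begin

section \<open>Sobolev space $H^1$\<close>

primrec continuously_differentiable :: "nat \<Rightarrow> ('a::euclidean_space \<Rightarrow> real) \<Rightarrow> bool" where
  "continuously_differentiable 0 f \<longleftrightarrow> continuous_on UNIV f"
| "continuously_differentiable (Suc k) f \<longleftrightarrow>
     f differentiable_on UNIV \<and>
     (\<forall>b\<in>Basis. continuously_differentiable k (\<lambda>x. frechet_derivative f (at x) b))"

definition test_function :: "'a::euclidean_space set \<Rightarrow> ('a \<Rightarrow> real) \<Rightarrow> bool" where
  "test_function \<Omega> \<phi> \<longleftrightarrow>
     (\<forall>k. continuously_differentiable k \<phi>) \<and>
     compact (closure {x. \<phi> x \<noteq> 0}) \<and> closure {x. \<phi> x \<noteq> 0} \<subseteq> \<Omega>"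

definition square_integrable_on ::
    "('a::euclidean_space \<Rightarrow> 'b::euclidean_space) \<Rightarrow> 'a set \<Rightarrow> bool"
    (infix "square'_integrable'_on" 50) where
  "f square_integrable_on \<Omega> \<longleftrightarrow>
     set_borel_measurable lebesgue \<Omega> f \<and> set_integrable lebesgue \<Omega> (\<lambda>x. (norm (f x))\<^sup>2)"

definition has_weak_gradient ::
    "('a::euclidean_space \<Rightarrow> real) \<Rightarrow> ('a \<Rightarrow> 'a) \<Rightarrow> 'a set \<Rightarrow> bool" where
  "has_weak_gradient u g \<Omega> \<longleftrightarrow>
     (\<forall>\<phi> b. test_function \<Omega> \<phi> \<and> b \<in> Basis \<longrightarrow>
        (LINT x:\<Omega>|lebesgue. u x * frechet_derivative \<phi> (at x) b) =
        - (LINT x:\<Omega>|lebesgue. (g x \<bullet> b) * \<phi> x))"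

definition H1 :: "'a::euclidean_space set \<Rightarrow> ('a \<Rightarrow> real) set" where
  "H1 \<Omega> = {u. u square_integrable_on \<Omega> \<and>
                (\<exists>g. g square_integrable_on \<Omega> \<and> has_weak_gradient u g \<Omega>)}"

text \<open>The weak gradient of an $H^1$ function is unique only up to null sets; an arbitrary
  representative is chosen, and it is used only under integrals over \<open>\<Omega>\<close>.\<close>

definition weak_gradient :: "'a::euclidean_space set \<Rightarrow> ('a \<Rightarrow> real) \<Rightarrow> 'a \<Rightarrow> 'a" where
  "weak_gradient \<Omega> u = (SOME g. g square_integrable_on \<Omega> \<and> has_weak_gradient u g \<Omega>)"


section \<open>Polyhedral domains and conforming simplicial triangulations\<close>

text \<open>A polyhedron is a finite union of (bounded, convex) polytopes, not necessarily convex
  itself; boundedness of the domain follows.\<close>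

definition bounded_polyhedral_domain :: "'a::euclidean_space set \<Rightarrow> bool" where
  "bounded_polyhedral_domain \<Omega> \<longleftrightarrow>
     \<Omega> \<noteq> {} \<and> open \<Omega> \<and> connected \<Omega> \<and>
     (\<exists>F. finite F \<and> (\<forall>P\<in>F. polytope P) \<and> \<Omega> = interior (\<Union>F))"

text \<open>The library notion \<^const>\<open>triangulation\<close> already provides finiteness and
  conformity: any two elements meet in a common (possibly empty) face. Elements are closed.\<close>

definition conforming_triangulation :: "'a::euclidean_space set set \<Rightarrow> 'a set \<Rightarrow> bool" where
  "conforming_triangulation \<T> \<Omega> \<longleftrightarrow>
     triangulation \<T> \<and> (\<forall>K\<in>\<T>. int DIM('a) simplex K) \<and> \<Union>\<T> = closure \<Omega>"

definition vertices :: "'a::euclidean_space set \<Rightarrow> 'a set" where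
  "vertices K = {v. v extreme_point_of K}"


section \<open>Finite element space and discrete operators\<close>

definition P1_on :: "'a::euclidean_space set \<Rightarrow> ('a \<Rightarrow> real) \<Rightarrow> bool" where
  "P1_on K v \<longleftrightarrow> (\<exists>c a. \<forall>x\<in>K. v x = c + a \<bullet> x)"

text \<open>Finite element functions are represented by their continuous representatives on the
  closure of \<open>\<Omega>\<close> (point values at vertices, including boundary vertices, are needed). The value
  0 outside the closure is only a normalisation of total functions, so that equality of
  functions is equality on the closure.\<close>

definition fe_space :: "'a::euclidean_space set \<Rightarrow> 'a set set \<Rightarrow> ('a \<Rightarrow> real) set" where
  "fe_space \<Omega> \<T> =
     {v. v \<in> H1 \<Omega> \<and> (\<forall>K\<in>\<T>. P1_on K v) \<and> (\<forall>x. x \<notin> closure \<Omega> \<longrightarrow> v x = 0)}"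

definition lumped_mass ::
    "'a::euclidean_space set set \<Rightarrow> ('a \<Rightarrow> real) \<Rightarrow> ('a \<Rightarrow> real) \<Rightarrow> real" where
  "lumped_mass \<T> \<alpha> \<beta> =
     (\<Sum>K\<in>\<T>. \<Sum>v\<in>vertices K. measure lebesgue K / (real DIM('a) + 1) * \<alpha> v * \<beta> v)"

definition stiffness ::
    "'a::euclidean_space set \<Rightarrow> ('a \<Rightarrow> real) \<Rightarrow> ('a \<Rightarrow> real) \<Rightarrow> ('a \<Rightarrow> real) \<Rightarrow> real" where
  "stiffness \<Omega> \<gamma> \<alpha> \<beta> =
     (LINT x:\<Omega>|lebesgue. \<gamma> x * (weak_gradient \<Omega> \<alpha> x \<bullet> weak_gradient \<Omega> \<beta> x))"

end

theory Submission
  imports Defs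
begin

text \<open>The scheme is the Euler-Lagrange equation on \<open>V\<^sub>h\<close> of the strictly convex energy
  \<open>\<Sum>\<^sub>i w\<^sub>i (exp (u p\<^sub>i) - g\<^sub>i u p\<^sub>i) + a(u, u) / 2\<close>, where \<open>p\<^sub>i\<close> runs over the vertices of the
  elements, \<open>w\<^sub>i > 0\<close> are the lumping weights divided by the time step, \<open>g\<^sub>i > 0\<close> is the previous
  density at \<open>p\<^sub>i\<close> and \<open>a\<close> is the stiffness form. As \<open>g\<^sub>i > 0\<close>, the energy is coercive in the vertex
  values, and these determine a finite element function, so a minimiser exists. Uniqueness follows
  by subtracting the equations of two solutions and testing with their difference, because the
  exponential is strictly increasing and \<open>a\<close> is positive semidefinite. Bilinearity of \<open>a\<close> rests on
  the almost everywhere uniqueness of weak gradients, i.e. on the fundamental lemma of the calculus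
  of variations.\<close>

section \<open>The fundamental lemma of the calculus of variations\<close>

text \<open>The power of \<open>inverse t\<close> is carried along because the derivatives of
  exp(-1/t), extended by zero, are linear combinations of such terms.\<close>

definition exp_bump :: "nat \<Rightarrow> real \<Rightarrow> real" where
  "exp_bump k t = (if t > 0 then exp (- inverse t) * inverse t ^ k else 0)"

text \<open>Substituting s = 1/t turns the right-hand limit into that of s^k / exp s at
  infinity.\<close>

lemma exp_bump_tendsto_0: "(exp_bump k \<longlongrightarrow> 0) (at 0)"
proof -
  have "((\<lambda>t::real. inverse t ^ k / exp (inverse t)) \<longlongrightarrow> 0) (at_right 0)"
    by (rule filterlim_compose[OF tendsto_power_div_exp_0 filterlim_inverse_at_top_right])
  then have "(exp_bump k \<longlongrightarrow> 0) (at_right 0)"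
    by (rule Lim_transform_eventually)
      (auto simp: exp_bump_def exp_minus field_simps eventually_at_filter)
  moreover have "(exp_bump k \<longlongrightarrow> 0) (at_left 0)"
    by (rule Lim_transform_eventually[OF tendsto_const])
      (auto simp: exp_bump_def eventually_at_filter)
  ultimately show ?thesis
    by (rule filterlim_split_at[rotated])
qed

lemma exp_bump_has_field_derivative:
  "(exp_bump k has_field_derivative exp_bump (k + 2) t - real k * exp_bump (k + 1) t) (at t)"
proof -
  consider "t > 0" | "t < 0" | "t = 0" by linarith
  then show ?thesis
  proof cases
    case 1
    have "((\<lambda>t. exp (- inverse t) * inverse t ^ k) has_field_derivative
        exp_bump (k + 2) t - real k * exp_bump (k + 1) t) (at t)"
      using 1 by (cases k; auto intro!: derivative_eq_intros simp: exp_bump_def algebra_simps power2_eq_square;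
          metis One_nat_def power_eq_if)
    then show ?thesis
      by (rule has_field_derivative_transform_within_open[where S = "{0<..}"])
        (use 1 in \<open>auto simp: exp_bump_def\<close>)
  next
    case 2
    have "((\<lambda>t. 0) has_field_derivative exp_bump (k + 2) t - real k * exp_bump (k + 1) t) (at t)"
      using 2 by (auto simp: exp_bump_def)
    then show ?thesis
      by (rule has_field_derivative_transform_within_open[where S = "{..<0}"])
        (use 2 in \<open>auto simp: exp_bump_def\<close>)
  next
    case 3
    \<comment> \<open>The difference quotient at 0 is \<open>exp_bump (Suc k)\<close>, whose limit
      is already known.\<close>
    have "((\<lambda>h. (exp_bump k (0 + h) - exp_bump k 0) / h) \<longlongrightarrow> 0) (at 0)"
      by (rule Lim_transform_eventually[OF exp_bump_tendsto_0[of "Suc k"]])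
        (auto simp: exp_bump_def eventually_at_filter field_simps)
    then show ?thesis
      using 3 by (simp add: DERIV_def exp_bump_def)
  qed
qed

text \<open>This class is closed under directional derivatives, which yields smoothness of all its
  members at once.\<close>

inductive bump_algebra :: "('a::euclidean_space \<Rightarrow> real) \<Rightarrow> bool" where
  const: "bump_algebra (\<lambda>x. c)"
| bump: "bump_algebra (\<lambda>x. exp_bump k (c + a \<bullet> x))"
| add: "bump_algebra f \<Longrightarrow> bump_algebra g \<Longrightarrow> bump_algebra (\<lambda>x. f x + g x)"
| mult: "bump_algebra f \<Longrightarrow> bump_algebra g \<Longrightarrow> bump_algebra (\<lambda>x. f x * g x)"

lemma bump_algebra_derivative:
  assumes "bump_algebra f"
  shows "\<exists>f'. (\<forall>x. (f has_derivative f' x) (at x)) \<and> (\<forall>b. bump_algebra (\<lambda>x. f' x b))"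
  using assms
proof induction
  case (const c)
  show ?case
    by (rule exI[of _ "\<lambda>_ _. 0"]) (auto intro: bump_algebra.const)
next
  case (bump k c a)
  \<comment> \<open>The minus sign is absorbed into a constant factor, so that the rules for
    constants, sums and products apply to the derivative.\<close>
  let ?f' = "\<lambda>x h. (a \<bullet> h) * (exp_bump (k + 2) (c + a \<bullet> x) + (- real k) * exp_bump (k + 1) (c + a \<bullet> x))"
  have "((\<lambda>x. exp_bump k (c + a \<bullet> x)) has_derivative ?f' x) (at x)" for x
  proof -
    have "((\<lambda>x. c + a \<bullet> x) has_derivative (\<lambda>h. a \<bullet> h)) (at x)"
      by (auto intro!: derivative_eq_intros)
    from has_derivative_compose[OF this
        exp_bump_has_field_derivative[of k "c + a \<bullet> x", unfolded has_field_derivative_def]]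
    show ?thesis
      by (rule has_derivative_eq_rhs) (auto simp: algebra_simps)
  qed
  moreover have "bump_algebra (\<lambda>x. ?f' x b)" for b
    by (intro bump_algebra.intros)
  ultimately show ?case
    by (intro exI[of _ ?f']) blast
next
  case (add f g)
  then obtain f' g' where "\<And>x. (f has_derivative f' x) (at x)" "\<And>b. bump_algebra (\<lambda>x. f' x b)"
      "\<And>x. (g has_derivative g' x) (at x)" "\<And>b. bump_algebra (\<lambda>x. g' x b)"
    by blast
  then show ?case
    by (intro exI[of _ "\<lambda>x h. f' x h + g' x h"])
      (auto intro: has_derivative_add bump_algebra.add)
next
  case (mult f g)
  then obtain f' g' where "\<And>x. (f has_derivative f' x) (at x)" "\<And>b. bump_algebra (\<lambda>x. f' x b)"
      "\<And>x. (g has_derivative g' x) (at x)" "\<And>b. bump_algebra (\<lambda>x. g' x b)"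
    by blast
  with mult.hyps show ?case
    by (intro exI[of _ "\<lambda>x h. f x * g' x h + f' x h * g x"] conjI allI
        has_derivative_mult bump_algebra.add bump_algebra.mult) auto
qed

text \<open>Induction on the order for all members of the class at once: every directional
  derivative is again a member, so the induction hypothesis covers it.\<close>

lemma bump_algebra_continuously_differentiable:
  "bump_algebra f \<Longrightarrow> continuously_differentiable k f"
proof (induction k arbitrary: f)
  case 0
  from bump_algebra_derivative[OF 0] obtain f' where "\<And>x. (f has_derivative f' x) (at x)"
    by blast
  then have "continuous (at x) f" for x
    using has_derivative_continuous by blast
  then show ?case by (simp add: continuous_on_eq_continuous_at)
next
  case (Suc k)
  from bump_algebra_derivative[OF Suc.prems] obtain f'
    where f': "\<And>x. (f has_derivative f' x) (at x)" "\<And>b. bump_algebra (\<lambda>x. f' x b)"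
    by blast
  then have "frechet_derivative f (at x) = f' x" for x
    by (metis frechet_derivative_at)
  with f' Suc.IH show ?case
    by (auto simp: differentiable_on_def differentiable_def)
qed

lemma bump_algebra_prod:
  assumes "finite A" "\<And>i. i \<in> A \<Longrightarrow> bump_algebra (f i)"
  shows "bump_algebra (\<lambda>x. \<Prod>i\<in>A. f i x)"
  using assms by (induction A) (auto intro: bump_algebra.intros)

section \<open>Smooth bumps approximating the indicator of a box\<close>

text \<open>In each coordinate there is one cutoff per face of the box. The scale
  \<open>Suc n\<close> is positive from n = 0 on and sharpens the cutoffs, so that the bumps tend to
  the indicator of the open box.\<close>

definition box_bump :: "'a::euclidean_space \<Rightarrow> 'a \<Rightarrow> nat \<Rightarrow> 'a \<Rightarrow> real" where
  "box_bump a b n x = (\<Prod>i\<in>Basis. exp_bump 0 (real (Suc n) * (x \<bullet> i - a \<bullet> i)) *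
                                 exp_bump 0 (real (Suc n) * (b \<bullet> i - x \<bullet> i)))"

lemma box_bump_smooth: "continuously_differentiable k (box_bump a b n)"
proof -
  \<comment> \<open>Each factor is brought into the form \<open>c + a \<bullet> x\<close> of the
    rule for bumps.\<close>
  have "bump_algebra (\<lambda>x. exp_bump 0 (- (real (Suc n) * (a \<bullet> i)) + (real (Suc n) *\<^sub>R i) \<bullet> x) *
      exp_bump 0 (real (Suc n) * (b \<bullet> i) + (- real (Suc n) *\<^sub>R i) \<bullet> x))" for i
    by (intro bump_algebra.intros)
  then have "bump_algebra (\<lambda>x. \<Prod>i\<in>Basis.
      exp_bump 0 (- (real (Suc n) * (a \<bullet> i)) + (real (Suc n) *\<^sub>R i) \<bullet> x) *
      exp_bump 0 (real (Suc n) * (b \<bullet> i) + (- real (Suc n) *\<^sub>R i) \<bullet> x))"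
    by (intro bump_algebra_prod) auto
  then have "bump_algebra (box_bump a b n)"
    by (rule back_subst[of bump_algebra])
      (auto simp: box_bump_def fun_eq_iff inner_commute right_diff_distrib simp del: of_nat_Suc
        intro!: prod.cong)
  then show ?thesis
    by (rule bump_algebra_continuously_differentiable)
qed

lemma box_bump_eq_0:
  assumes "x \<notin> box a b"
  shows "box_bump a b n x = 0"
proof -
  from assms obtain i where "i \<in> Basis" "x \<bullet> i \<le> a \<bullet> i \<or> b \<bullet> i \<le> x \<bullet> i"
    by (force simp: mem_box)
  then show ?thesis
    unfolding box_bump_def
    by (intro prod_zero) (auto simp: exp_bump_def mult_le_0_iff zero_less_mult_iff intro!: bexI[of _ i])
qed

lemma exp_bump_bounds: "0 \<le> exp_bump 0 t" "exp_bump 0 t \<le> 1"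
  by (auto simp: exp_bump_def)

lemma box_bump_bound: "norm (box_bump a b n x) \<le> 1"
  unfolding box_bump_def prod_norm[symmetric]
  by (intro prod_le_1) (auto simp: exp_bump_bounds abs_mult mult_le_one)

lemma exp_bump_tendsto_1:
  assumes "t > 0"
  shows "(\<lambda>n. exp_bump 0 (real (Suc n) * t)) \<longlonglongrightarrow> 1"
proof -
  have "(\<lambda>n. exp (- (inverse (real (Suc n)) * inverse t))) \<longlonglongrightarrow> exp (- (0 * inverse t))"
    by (intro tendsto_intros LIMSEQ_inverse_real_of_nat)
  moreover have "exp (- (inverse (real (Suc n)) * inverse t)) = exp_bump 0 (real (Suc n) * t)" for n
    using assms by (simp add: exp_bump_def inverse_mult_distrib del: of_nat_Suc)
  ultimately show ?thesis by simp
qed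

lemma box_bump_tendsto: "(\<lambda>n. box_bump a b n x) \<longlonglongrightarrow> indicator (box a b) x"
proof (cases "x \<in> box a b")
  case True
  have "(\<lambda>n. box_bump a b n x) \<longlonglongrightarrow> (\<Prod>i\<in>(Basis :: 'a set). 1 * 1)"
    unfolding box_bump_def using True
    by (intro tendsto_prod tendsto_mult exp_bump_tendsto_1) (auto simp: mem_box)
  with True show ?thesis by simp
next
  case False
  then show ?thesis by (simp add: box_bump_eq_0)
qed

lemma box_bump_test_function:
  assumes "cbox a b \<subseteq> \<Omega>"
  shows "test_function \<Omega> (box_bump a b n)"
proof -
  have "closure {x. box_bump a b n x \<noteq> 0} \<subseteq> cbox a b"
    by (rule closure_minimal) (use box_bump_eq_0 box_subset_cbox in blast)+
  moreover from this have "compact (closure {x. box_bump a b n x \<noteq> 0})"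
    by (meson bounded_cbox bounded_subset closed_closure compact_eq_bounded_closed)
  ultimately show ?thesis
    using assms by (auto simp: test_function_def box_bump_smooth)
qed

text \<open>Testing with bumps and passing to the limit gives zero integral over every box inside
  \<Omega>. Lebesgue differentiation recovers the function almost everywhere from its averages over
  small boxes.\<close>

lemma set_integrable_AE_0_of_test_functions:
  fixes h :: "'a::euclidean_space \<Rightarrow> real"
  assumes "open \<Omega>" and int: "set_integrable lebesgue \<Omega> h"
    and orth: "\<And>\<phi>. test_function \<Omega> \<phi> \<Longrightarrow> (LINT x:\<Omega>|lebesgue. h x * \<phi> x) = 0"
  shows "AE x in lebesgue. x \<in> \<Omega> \<longrightarrow> h x = 0"
proof -
  \<comment> \<open>Extension by zero makes the function integrable on the whole space, where the
    differentiation theorem is applied.\<close>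
  define f where "f x = indicator \<Omega> x * h x" for x
  have f: "integrable lebesgue f"
    using int by (simp add: set_integrable_def f_def[abs_def])
  have cont: "continuous_on UNIV (box_bump a b n)" for a b :: 'a and n
    using box_bump_smooth[of 0 a b n] by simp
  have meas: "box_bump a b n \<in> borel_measurable lebesgue" for a b :: 'a and n
    using borel_measurable_continuous_onI[OF cont] by (simp add: measurable_completion)
  have box0: "integral (cbox a b) f = 0" if ab: "cbox a b \<subseteq> \<Omega>" for a b
  proof -
    have "(\<lambda>n. LINT x|lebesgue. f x * box_bump a b n x) \<longlonglongrightarrow>
        (LINT x|lebesgue. f x * indicator (box a b) x)"
    proof (rule integral_dominated_convergence[where w = "\<lambda>x. norm (f x)"])
      show "AE x in lebesgue. (\<lambda>n. f x * box_bump a b n x) \<longlonglongrightarrow> f x * indicator (box a b) x"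
        by (intro AE_I2 tendsto_intros box_bump_tendsto)
      show "AE x in lebesgue. norm (f x * box_bump a b n x) \<le> norm (f x)" for n
        using box_bump_bound[of a b n] by (intro AE_I2) (auto simp: abs_mult intro!: mult_left_le)
    qed (use f meas borel_measurable_integrable[OF f] in \<open>auto intro!: borel_measurable_times borel_measurable_indicator\<close>)
    moreover have "(LINT x|lebesgue. f x * box_bump a b n x) = 0" for n
      using orth[OF box_bump_test_function[OF ab]]
      by (simp add: set_lebesgue_integral_def f_def mult_ac)
    ultimately have "(LINT x|lebesgue. f x * indicator (box a b) x) = 0"
      by (simp add: LIMSEQ_const_iff)
    then have "(LINT x:box a b|lebesgue. f x) = 0"
      by (simp add: set_lebesgue_integral_def mult.commute)
    moreover have "set_integrable lebesgue (box a b) f"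
      unfolding set_integrable_def using f by (intro integrable_mult_indicator) auto
    ultimately have "integral (box a b) f = 0"
      by (simp add: set_lebesgue_integral_eq_integral(2))
    then show ?thesis by (simp add: integral_open_interval)
  qed
  have "f integrable_on cbox a b" for a b
  proof -
    have "set_integrable lebesgue (cbox a b) f"
      unfolding set_integrable_def using f by (intro integrable_mult_indicator) auto
    then show ?thesis by (rule set_lebesgue_integral_eq_integral(1))
  qed
  \<comment> \<open>Lebesgue differentiation along cubes having x as their lower corner.\<close>
  then obtain N where N: "negligible N"
    and diff: "\<And>x e. \<lbrakk>x \<notin> N; 0 < e\<rbrakk> \<Longrightarrow> \<exists>d>0. \<forall>h. 0 < h \<and> h < d \<longrightarrow>
        norm (integral (cbox x (x + h *\<^sub>R One)) f /\<^sub>R h ^ DIM('a) - f x) < e"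
    using integrable_ccontinuous_explicit[of f] by blast
  have "h x = 0" if "x \<notin> N" "x \<in> \<Omega>" for x
  proof (rule ccontr)
    assume "h x \<noteq> 0"
    with that obtain d where d: "d > 0" "\<And>h. 0 < h \<and> h < d \<Longrightarrow>
        norm (integral (cbox x (x + h *\<^sub>R One)) f /\<^sub>R h ^ DIM('a) - f x) < norm (f x)"
      using diff[of x "norm (f x)"] by (auto simp: f_def)
    obtain r where r: "r > 0" "ball x r \<subseteq> \<Omega>"
      using \<open>open \<Omega>\<close> \<open>x \<in> \<Omega>\<close> openE by blast
    \<comment> \<open>Side length below \<open>d\<close>, so that the average is close to
      \<open>f x\<close>, and small enough for the cube to stay in the ball; the halves make both
      bounds strict.\<close>
    define t where "t = min (d / 2) (r / (2 * norm (One :: 'a)))"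
    have One: "norm (One :: 'a) > 0" by simp
    have t: "0 < t" "t < d" "t * norm (One :: 'a) < r"
      using d(1) r(1) One by (auto simp: t_def min_def field_simps)
    have "cbox x (x + t *\<^sub>R One) \<subseteq> ball x r"
    proof
      fix y assume "y \<in> cbox x (x + t *\<^sub>R One)"
      then have "norm (y - x) \<le> norm (t *\<^sub>R (One :: 'a))"
        using t(1) by (intro norm_le_componentwise) (auto simp: mem_box inner_diff_left inner_add_left)
      with t show "y \<in> ball x r" by (simp add: dist_norm norm_minus_commute)
    qed
    with box0 r have "integral (cbox x (x + t *\<^sub>R One)) f = 0" by blast
    with d(2)[of t] t show False by simp
  qed
  then have "{x. \<not> (x \<in> \<Omega> \<longrightarrow> h x = 0)} \<subseteq> N" by blast
  with N show ?thesis
    by (intro AE_I'[of N]) (auto simp: negligible_iff_null_sets)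
qed

section \<open>Weak gradients and the stiffness form\<close>

lemma set_integrable_bound_AE:
  fixes f :: "'a \<Rightarrow> 'b::{banach, second_countable_topology}" and h :: "'a \<Rightarrow> real"
  assumes "set_integrable M A h" "set_borel_measurable M A f" "\<And>x. x \<in> A \<Longrightarrow> norm (f x) \<le> h x"
  shows "set_integrable M A f"
  unfolding set_integrable_def
proof (rule Bochner_Integration.integrable_bound)
  show "integrable M (\<lambda>x. indicator A x *\<^sub>R h x)"
    using assms(1) by (simp add: set_integrable_def)
  show "AE x in M. norm (indicator A x *\<^sub>R f x) \<le> norm (indicator A x *\<^sub>R h x)"
    using order_trans[OF assms(3) abs_ge_self] by (intro AE_I2) (auto simp: indicator_def)
qed (use assms(2) in \<open>simp add: set_borel_measurable_def\<close>)

text \<open>The indicator is idempotent, so truncating both factors is the same as truncating the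
  inner product.\<close>

lemma set_borel_measurable_inner:
  fixes f g :: "'a \<Rightarrow> 'b::euclidean_space"
  assumes "set_borel_measurable M A f" "set_borel_measurable M A g"
  shows "set_borel_measurable M A (\<lambda>x. f x \<bullet> g x)"
proof -
  have "(\<lambda>x. (indicator A x *\<^sub>R f x) \<bullet> (indicator A x *\<^sub>R g x)) \<in> borel_measurable M"
    using assms by (intro borel_measurable_inner) (auto simp: set_borel_measurable_def)
  then show ?thesis
    unfolding set_borel_measurable_def
    by (rule measurable_cong[THEN iffD1, rotated]) (auto simp: indicator_def)
qed

lemma set_borel_measurable_add_scale:
  fixes f g :: "'a \<Rightarrow> 'b::euclidean_space"
  assumes "set_borel_measurable M A f" "set_borel_measurable M A g"
  shows "set_borel_measurable M A (\<lambda>x. f x + s *\<^sub>R g x)"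
proof -
  have "(\<lambda>x. (indicator A x *\<^sub>R f x) + s *\<^sub>R (indicator A x *\<^sub>R g x)) \<in> borel_measurable M"
    using assms unfolding set_borel_measurable_def
    by (intro borel_measurable_add borel_measurable_scaleR[OF borel_measurable_const])
  then show ?thesis
    unfolding set_borel_measurable_def
    by (rule measurable_cong[THEN iffD1, rotated]) (auto simp: indicator_def)
qed

lemma set_integrable_mult_bounded:
  fixes h \<psi> :: "'a \<Rightarrow> real"
  assumes h: "set_integrable M A h" and \<psi>: "set_borel_measurable M A \<psi>"
    and C: "\<And>x. x \<in> A \<Longrightarrow> \<bar>\<psi> x\<bar> \<le> C"
  shows "set_integrable M A (\<lambda>x. \<psi> x * h x)"
proof (rule set_integrable_bound_AE)
  show "set_integrable M A (\<lambda>x. C * \<bar>h x\<bar>)"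
    using h by (intro set_integrable_mult_right set_integrable_abs) auto
  have "set_borel_measurable M A h"
    using h by (auto simp: set_borel_measurable_def set_integrable_def)
  from set_borel_measurable_inner[OF \<psi> this] show "set_borel_measurable M A (\<lambda>x. \<psi> x * h x)"
    by simp
  show "norm (\<psi> x * h x) \<le> C * \<bar>h x\<bar>" if "x \<in> A" for x
    using C[OF that] by (simp add: abs_mult mult_right_mono)
qed

text \<open>Cauchy-Schwarz and Young's inequality give the integrable majorant |f|^2 +
  |g|^2.\<close>

lemma square_integrable_inner:
  fixes f g :: "'a::euclidean_space \<Rightarrow> 'b::euclidean_space"
  assumes "f square_integrable_on A" "g square_integrable_on A"
  shows "set_integrable lebesgue A (\<lambda>x. f x \<bullet> g x)"
proof (rule set_integrable_bound_AE)
  show "set_integrable lebesgue A (\<lambda>x. (norm (f x))\<^sup>2 + (norm (g x))\<^sup>2)"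
    using assms by (intro set_integral_add(1)) (auto simp: square_integrable_on_def)
  show "set_borel_measurable lebesgue A (\<lambda>x. f x \<bullet> g x)"
    using assms by (intro set_borel_measurable_inner) (auto simp: square_integrable_on_def)
  fix x
  have "\<bar>f x \<bullet> g x\<bar> \<le> norm (f x) * norm (g x)" by (rule Cauchy_Schwarz_ineq2)
  also have "\<dots> \<le> (norm (f x))\<^sup>2 + (norm (g x))\<^sup>2"
    using sum_squares_bound[of "norm (f x)" "norm (g x)"]
      mult_nonneg_nonneg[OF norm_ge_zero[of "f x"] norm_ge_zero[of "g x"]] by linarith
  finally show "norm (f x \<bullet> g x) \<le> (norm (f x))\<^sup>2 + (norm (g x))\<^sup>2" by simp
qed

lemma square_integrable_add_scale:
  fixes f g :: "'a::euclidean_space \<Rightarrow> 'b::euclidean_space"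
  assumes "f square_integrable_on A" "g square_integrable_on A"
  shows "(\<lambda>x. f x + s *\<^sub>R g x) square_integrable_on A"
proof -
  have "set_integrable lebesgue A (\<lambda>x. f x \<bullet> f x + 2 * s * (f x \<bullet> g x) + s\<^sup>2 * (g x \<bullet> g x))"
    using assms by (intro set_integral_add(1) set_integrable_mult_right square_integrable_inner)
  moreover have "(norm (f x + s *\<^sub>R g x))\<^sup>2 = f x \<bullet> f x + 2 * s * (f x \<bullet> g x) + s\<^sup>2 * (g x \<bullet> g x)" for x
    unfolding power2_norm_eq_inner by (simp add: inner_commute algebra_simps power2_eq_square)
  ultimately show ?thesis
    using assms by (simp add: square_integrable_on_def set_borel_measurable_add_scale)
qed

text \<open>Pairing with constants through \<open>square_integrable_inner\<close> turns square
  integrability into integrability on sets of finite measure.\<close>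

lemma square_integrable_const:
  fixes c :: "'b::euclidean_space"
  assumes "A \<in> lmeasurable"
  shows "(\<lambda>x. c) square_integrable_on A"
  unfolding square_integrable_on_def set_borel_measurable_def set_integrable_def
  using assms
  by (auto simp: fmeasurable_def intro!: borel_measurable_scaleR borel_measurable_indicator
      integrable_real_mult_indicator integrable_mult_left)

text \<open>The continuous factor is bounded on the compact closure of the set.\<close>

lemma set_integrable_mult_continuous:
  fixes h \<psi> :: "'a::euclidean_space \<Rightarrow> real"
  assumes "bounded A" "A \<in> sets lebesgue" and h: "set_integrable lebesgue A h"
    and \<psi>: "continuous_on UNIV \<psi>"
  shows "set_integrable lebesgue A (\<lambda>x. h x * \<psi> x)"
proof -
  have "bounded (\<psi> ` closure A)"
    using assms(1) \<psi> by (intro compact_imp_bounded compact_continuous_image)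
      (auto intro: continuous_on_subset)
  then obtain C where "\<And>x. x \<in> A \<Longrightarrow> \<bar>\<psi> x\<bar> \<le> C"
    using closure_subset[of A] by (force simp: bounded_iff)
  moreover have "\<psi> \<in> borel_measurable lebesgue"
    using borel_measurable_continuous_onI[OF \<psi>] by (simp add: measurable_completion)
  then have "set_borel_measurable lebesgue A \<psi>"
    using assms(2) by (simp add: set_borel_measurable_def)
  ultimately have "set_integrable lebesgue A (\<lambda>x. \<psi> x * h x)"
    using h by (intro set_integrable_mult_bounded)
  then show ?thesis by (simp add: mult.commute)
qed

section \<open>Weak gradients on a bounded open set\<close>

locale bounded_open_set =
  fixes \<Omega> :: "'a::euclidean_space set"
  assumes open_\<Omega>: "open \<Omega>" and bounded_\<Omega>: "bounded \<Omega>"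
begin

lemma sets_\<Omega>: "\<Omega> \<in> sets lebesgue"
  using open_\<Omega> by simp

lemma lmeasurable_\<Omega>: "\<Omega> \<in> lmeasurable"
  using bounded_\<Omega> sets_\<Omega> by (rule bounded_set_imp_lmeasurable)

lemma integrable_times_test_derivative:
  assumes "u square_integrable_on \<Omega>" "test_function \<Omega> \<phi>" "b \<in> Basis"
  shows "set_integrable lebesgue \<Omega> (\<lambda>x. u x * frechet_derivative \<phi> (at x) b)"
proof (rule set_integrable_mult_continuous[OF bounded_\<Omega> sets_\<Omega>])
  show "set_integrable lebesgue \<Omega> u"
    using square_integrable_inner[OF assms(1) square_integrable_const[OF lmeasurable_\<Omega>, of 1]] by simp
  have "continuously_differentiable (Suc 0) \<phi>"
    using assms(2) unfolding test_function_def by blast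
  then show "continuous_on UNIV (\<lambda>x. frechet_derivative \<phi> (at x) b)"
    using assms(3) by simp
qed

lemma integrable_times_test:
  assumes "g square_integrable_on \<Omega>" "test_function \<Omega> \<phi>"
  shows "set_integrable lebesgue \<Omega> (\<lambda>x. (g x \<bullet> b) * \<phi> x)"
proof (rule set_integrable_mult_continuous[OF bounded_\<Omega> sets_\<Omega>])
  show "set_integrable lebesgue \<Omega> (\<lambda>x. g x \<bullet> b)"
    by (intro square_integrable_inner assms square_integrable_const lmeasurable_\<Omega>)
  have "continuously_differentiable 0 \<phi>"
    using assms(2) unfolding test_function_def by blast
  then show "continuous_on UNIV \<phi>" by simp
qed

text \<open>Both sides of the integration by parts identity are linear; the integrability lemmas
  above justify splitting the integrals.\<close>

lemma weak_gradient_add_scale: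
  assumes u: "u square_integrable_on \<Omega>" "gu square_integrable_on \<Omega>" "has_weak_gradient u gu \<Omega>"
    and v: "v square_integrable_on \<Omega>" "gv square_integrable_on \<Omega>" "has_weak_gradient v gv \<Omega>"
  shows "has_weak_gradient (\<lambda>x. u x + s * v x) (\<lambda>x. gu x + s *\<^sub>R gv x) \<Omega>"
  unfolding has_weak_gradient_def
proof (intro allI impI, elim conjE)
  fix \<phi> :: "'a \<Rightarrow> real" and b :: 'a
  assume \<phi>: "test_function \<Omega> \<phi>" and b: "b \<in> Basis"
  let ?d = "\<lambda>x. frechet_derivative \<phi> (at x) b"
  have "(LINT x:\<Omega>|lebesgue. (u x + s * v x) * ?d x) =
      (LINT x:\<Omega>|lebesgue. u x * ?d x + s * (v x * ?d x))"
    by (simp add: algebra_simps)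
  also have "\<dots> = (LINT x:\<Omega>|lebesgue. u x * ?d x) + s * (LINT x:\<Omega>|lebesgue. v x * ?d x)"
    by (subst set_integral_add(2))
      (auto intro!: integrable_times_test_derivative u v \<phi> b set_integrable_mult_right)
  also have "\<dots> = - ((LINT x:\<Omega>|lebesgue. (gu x \<bullet> b) * \<phi> x) + s * (LINT x:\<Omega>|lebesgue. (gv x \<bullet> b) * \<phi> x))"
    using u(3) v(3) \<phi> b by (simp add: has_weak_gradient_def)
  also have "\<dots> = - (LINT x:\<Omega>|lebesgue. (gu x \<bullet> b) * \<phi> x + s * ((gv x \<bullet> b) * \<phi> x))"
    by (subst set_integral_add(2))
      (auto intro!: integrable_times_test u v \<phi> set_integrable_mult_right)
  finally show "(LINT x:\<Omega>|lebesgue. (u x + s * v x) * ?d x) =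
      - (LINT x:\<Omega>|lebesgue. ((gu x + s *\<^sub>R gv x) \<bullet> b) * \<phi> x)"
    by (simp add: algebra_simps)
qed

text \<open>The fundamental lemma applies to each component of the difference, and finitely many
  null sets are combined.\<close>

lemma weak_gradient_unique:
  assumes g: "g square_integrable_on \<Omega>" "has_weak_gradient u g \<Omega>"
    and g': "g' square_integrable_on \<Omega>" "has_weak_gradient u g' \<Omega>"
  shows "AE x in lebesgue. x \<in> \<Omega> \<longrightarrow> g x = g' x"
proof -
  have "AE x in lebesgue. x \<in> \<Omega> \<longrightarrow> g x \<bullet> b - g' x \<bullet> b = 0" if b: "b \<in> Basis" for b
  proof (rule set_integrable_AE_0_of_test_functions[OF open_\<Omega>])
    show "set_integrable lebesgue \<Omega> (\<lambda>x. g x \<bullet> b - g' x \<bullet> b)"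
      by (intro set_integral_diff(1) square_integrable_inner g g' square_integrable_const lmeasurable_\<Omega>)
    fix \<phi> assume \<phi>: "test_function \<Omega> \<phi>"
    have "(LINT x:\<Omega>|lebesgue. (g x \<bullet> b - g' x \<bullet> b) * \<phi> x) =
        (LINT x:\<Omega>|lebesgue. (g x \<bullet> b) * \<phi> x) - (LINT x:\<Omega>|lebesgue. (g' x \<bullet> b) * \<phi> x)"
      unfolding left_diff_distrib by (intro set_integral_diff(2) integrable_times_test g g' \<phi>)
    also have "\<dots> = 0"
      using g(2) g'(2) \<phi> b by (fastforce simp: has_weak_gradient_def)
    finally show "(LINT x:\<Omega>|lebesgue. (g x \<bullet> b - g' x \<bullet> b) * \<phi> x) = 0" .
  qed
  then have "AE x in lebesgue. \<forall>b\<in>Basis. x \<in> \<Omega> \<longrightarrow> g x \<bullet> b - g' x \<bullet> b = 0"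
    by (rule AE_finite_allI[OF finite_Basis])
  then show ?thesis
    by (rule eventually_mono) (auto simp: euclidean_eq_iff[of "g _" "g' _"])
qed

lemma H1_weak_gradient:
  assumes "u \<in> H1 \<Omega>"
  shows "weak_gradient \<Omega> u square_integrable_on \<Omega>" "has_weak_gradient u (weak_gradient \<Omega> u) \<Omega>"
proof -
  have "\<exists>g. g square_integrable_on \<Omega> \<and> has_weak_gradient u g \<Omega>"
    using assms by (simp add: H1_def)
  from someI_ex[OF this] show "weak_gradient \<Omega> u square_integrable_on \<Omega>"
    "has_weak_gradient u (weak_gradient \<Omega> u) \<Omega>"
    by (simp_all add: weak_gradient_def)
qed

lemma H1_zero: "(\<lambda>_. 0) \<in> H1 \<Omega>"
proof -
  have "has_weak_gradient (\<lambda>_. 0) (\<lambda>_. 0) \<Omega>"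
    by (simp add: has_weak_gradient_def)
  then show ?thesis
    using square_integrable_const[OF lmeasurable_\<Omega>, of "0::real"]
      square_integrable_const[OF lmeasurable_\<Omega>, of "0::'a"]
    by (auto simp: H1_def)
qed

lemma H1_add_scale:
  assumes "u \<in> H1 \<Omega>" "v \<in> H1 \<Omega>"
  shows "(\<lambda>x. u x + s * v x) \<in> H1 \<Omega>"
proof -
  have uv: "u square_integrable_on \<Omega>" "v square_integrable_on \<Omega>"
    using assms by (simp_all add: H1_def)
  show ?thesis
    unfolding H1_def
    using square_integrable_add_scale[OF uv, of s]
      square_integrable_add_scale[OF assms[THEN H1_weak_gradient(1)], of s]
      weak_gradient_add_scale[OF uv(1) H1_weak_gradient[OF assms(1)] uv(2) H1_weak_gradient[OF assms(2)], of s]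
    by auto
qed

text \<open>The representatives are chosen independently for each function, so linearity can only
  come from uniqueness: both sides are weak gradients of the same function.\<close>

lemma weak_gradient_linear_AE:
  assumes "u \<in> H1 \<Omega>" "v \<in> H1 \<Omega>"
  shows "AE x in lebesgue. x \<in> \<Omega> \<longrightarrow>
    weak_gradient \<Omega> (\<lambda>x. u x + s * v x) x = weak_gradient \<Omega> u x + s *\<^sub>R weak_gradient \<Omega> v x"
proof (rule weak_gradient_unique[where u = "\<lambda>x. u x + s * v x"])
  have uv: "u square_integrable_on \<Omega>" "v square_integrable_on \<Omega>"
    using assms by (simp_all add: H1_def)
  show "(\<lambda>x. weak_gradient \<Omega> u x + s *\<^sub>R weak_gradient \<Omega> v x) square_integrable_on \<Omega>"
    by (rule square_integrable_add_scale[OF assms[THEN H1_weak_gradient(1)]])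
  show "has_weak_gradient (\<lambda>x. u x + s * v x)
      (\<lambda>x. weak_gradient \<Omega> u x + s *\<^sub>R weak_gradient \<Omega> v x) \<Omega>"
    by (rule weak_gradient_add_scale[OF uv(1) H1_weak_gradient[OF assms(1)] uv(2) H1_weak_gradient[OF assms(2)]])
qed (rule H1_weak_gradient[OF H1_add_scale[OF assms]])+

section \<open>The stiffness form is symmetric, positive semidefinite and linear\<close>

lemma stiffness_commute: "stiffness \<Omega> \<gamma> u v = stiffness \<Omega> \<gamma> v u"
  by (simp add: stiffness_def inner_commute)

lemma stiffness_nonneg:
  assumes "\<And>x. \<gamma> x \<ge> 0"
  shows "stiffness \<Omega> \<gamma> u u \<ge> 0"
  unfolding stiffness_def set_lebesgue_integral_def
  using assms by (intro Bochner_Integration.integral_nonneg) auto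

lemma stiffness_integrable:
  assumes "u \<in> H1 \<Omega>" "v \<in> H1 \<Omega>"
    and "set_borel_measurable lebesgue \<Omega> \<gamma>" "\<And>x. x \<in> \<Omega> \<Longrightarrow> \<bar>\<gamma> x\<bar> \<le> C"
  shows "set_integrable lebesgue \<Omega> (\<lambda>x. \<gamma> x * (weak_gradient \<Omega> u x \<bullet> weak_gradient \<Omega> v x))"
  using assms by (intro set_integrable_mult_bounded[where C = C] square_integrable_inner H1_weak_gradient)

lemma stiffness_linear:
  assumes u: "u \<in> H1 \<Omega>" and v: "v \<in> H1 \<Omega>" and z: "z \<in> H1 \<Omega>"
    and \<gamma>: "set_borel_measurable lebesgue \<Omega> \<gamma>" "\<And>x. x \<in> \<Omega> \<Longrightarrow> \<bar>\<gamma> x\<bar> \<le> C"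
  shows "stiffness \<Omega> \<gamma> (\<lambda>x. u x + s * v x) z = stiffness \<Omega> \<gamma> u z + s * stiffness \<Omega> \<gamma> v z"
proof -
  let ?G = "weak_gradient \<Omega>"
  have int: "set_integrable lebesgue \<Omega> (\<lambda>x. \<gamma> x * (?G f x \<bullet> ?G z x))" if "f \<in> H1 \<Omega>" for f
    using stiffness_integrable[OF that z \<gamma>] .
  have "stiffness \<Omega> \<gamma> (\<lambda>x. u x + s * v x) z =
      (LINT x:\<Omega>|lebesgue. \<gamma> x * (?G u x \<bullet> ?G z x) + s * (\<gamma> x * (?G v x \<bullet> ?G z x)))"
    unfolding stiffness_def set_lebesgue_integral_def
  \<comment> \<open>The integrands agree only almost everywhere, hence the measurability
    obligations.\<close>
  proof (rule integral_cong_AE)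
    show "(\<lambda>x. indicat_real \<Omega> x *\<^sub>R (\<gamma> x * (?G (\<lambda>x. u x + s * v x) x \<bullet> ?G z x)))
        \<in> borel_measurable lebesgue"
      using int[OF H1_add_scale[OF u v]] unfolding set_integrable_def by blast
    have "set_integrable lebesgue \<Omega> (\<lambda>x. \<gamma> x * (?G u x \<bullet> ?G z x) + s * (\<gamma> x * (?G v x \<bullet> ?G z x)))"
      by (intro set_integral_add(1) set_integrable_mult_right int u v)
    then show "(\<lambda>x. indicat_real \<Omega> x *\<^sub>R (\<gamma> x * (?G u x \<bullet> ?G z x) + s * (\<gamma> x * (?G v x \<bullet> ?G z x))))
        \<in> borel_measurable lebesgue"
      unfolding set_integrable_def by blast
    show "AE x in lebesgue. indicat_real \<Omega> x *\<^sub>R (\<gamma> x * (?G (\<lambda>x. u x + s * v x) x \<bullet> ?G z x)) =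
        indicat_real \<Omega> x *\<^sub>R (\<gamma> x * (?G u x \<bullet> ?G z x) + s * (\<gamma> x * (?G v x \<bullet> ?G z x)))"
      using weak_gradient_linear_AE[OF u v, of s]
      by eventually_elim (auto simp: indicator_def algebra_simps)
  qed
  also have "\<dots> = (LINT x:\<Omega>|lebesgue. \<gamma> x * (?G u x \<bullet> ?G z x))
      + (LINT x:\<Omega>|lebesgue. s * (\<gamma> x * (?G v x \<bullet> ?G z x)))"
    by (intro set_integral_add(2) set_integrable_mult_right int u v)
  finally show ?thesis by (simp add: stiffness_def)
qed

end

section \<open>A semilinear problem with exponential nonlinearity\<close>

text \<open>The left-hand side is the tangent to \<open>exp\<close> at \<open>ln g\<close>, where
  the slope is \<open>g\<close>; the exponential is convex.\<close>

lemma exp_tangent_lower_bound: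
  fixes g y :: real
  assumes "g > 0"
  shows "g * (1 + y - ln g) \<le> exp y"
proof -
  have "g * (1 + (y - ln g)) \<le> g * exp (y - ln g)"
    using assms by (intro mult_left_mono exp_ge_add_one_self) auto
  also have "\<dots> = exp y"
    using assms by (simp add: exp_diff)
  finally show ?thesis by (simp add: algebra_simps)
qed

text \<open>For large positive y the exponential dominates; for large negative y the growth comes
  from \<open>- g * y\<close>, which is where positivity of \<open>g\<close> enters.\<close>

lemma exp_minus_linear_coercive:
  fixes g :: real
  assumes "g > 0"
  obtains C where "\<And>y. g / 2 * \<bar>y\<bar> - C \<le> exp y - g * y"
proof
  fix y :: real
  \<comment> \<open>the tangents to \<open>exp\<close> of slopes \<open>2 g\<close> and \<open>g / 2\<close> control the growth on either side\<close>
  let ?C = "\<bar>2 * g * (1 - ln (2 * g))\<bar> + \<bar>g / 2 * (1 - ln (g / 2))\<bar>"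
  have "2 * g * (1 + y - ln (2 * g)) \<le> exp y" "g / 2 * (1 + y - ln (g / 2)) \<le> exp y"
    using assms by (intro exp_tangent_lower_bound; simp)+
  then have "2 * g * (1 - ln (2 * g)) + g * y \<le> exp y - g * y"
      "g / 2 * (1 - ln (g / 2)) - g / 2 * y \<le> exp y - g * y"
    by (simp_all add: algebra_simps)
  moreover have "g / 2 * \<bar>y\<bar> \<le> g * y \<or> g / 2 * \<bar>y\<bar> = - g / 2 * y"
    using assms by (cases "y \<ge> 0") (auto simp: field_simps)
  ultimately show "g / 2 * \<bar>y\<bar> - ?C \<le> exp y - g * y"
    by linarith
qed

section \<open>Linear spaces of functions and bases adapted to point values\<close>

locale function_space =
  fixes W :: "('a \<Rightarrow> real) set"
  assumes zero: "(\<lambda>_. 0) \<in> W"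
    and add_scale: "u \<in> W \<Longrightarrow> v \<in> W \<Longrightarrow> (\<lambda>x. u x + s * v x) \<in> W"
begin

lemma diff: "u \<in> W \<Longrightarrow> v \<in> W \<Longrightarrow> (\<lambda>x. u x - v x) \<in> W"
  using add_scale[of u v "-1"] by simp

lemma scale: "v \<in> W \<Longrightarrow> (\<lambda>x. s * v x) \<in> W"
  using add_scale[OF zero, of v s] by simp

lemma lincomb: "finite B \<Longrightarrow> (\<And>b. b \<in> B \<Longrightarrow> \<phi> b \<in> W) \<Longrightarrow> (\<lambda>x. \<Sum>b\<in>B. c b * \<phi> b x) \<in> W"
proof (induction B rule: finite_induct)
  case empty
  then show ?case by (simp add: zero)
next
  case (insert b B)
  then have "(\<lambda>x. (\<Sum>b\<in>B. c b * \<phi> b x) + c b * \<phi> b x) \<in> W"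
    by (intro add_scale) auto
  with insert.hyps show ?case by (simp add: add.commute)
qed

text \<open>The coordinates are point values, so that bounds on point values bound the coordinates.\<close>

lemma interpolatory_basis:
  assumes "finite S"
  shows "\<exists>B \<phi>. B \<subseteq> S \<and> (\<forall>b\<in>B. \<phi> b \<in> W) \<and>
    (\<forall>w\<in>W. \<forall>x\<in>S. w x = (\<Sum>b\<in>B. w b * \<phi> b x))"
  using assms
proof (induction S rule: finite_induct)
  case empty
  show ?case by auto
next
  case (insert p S)
  then obtain B \<phi> where B: "B \<subseteq> S" "\<And>b. b \<in> B \<Longrightarrow> \<phi> b \<in> W"
    and rep: "\<And>w x. w \<in> W \<Longrightarrow> x \<in> S \<Longrightarrow> w x = (\<Sum>b\<in>B. w b * \<phi> b x)"
    by blast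
  have fin: "finite B" and p: "p \<notin> B"
    using B insert.hyps finite_subset by auto
  \<comment> \<open>The residual of interpolation at the points chosen so far; it vanishes on
    \<open>S\<close>, so only its value at \<open>p\<close> matters.\<close>
  define r where "r w x = w x - (\<Sum>b\<in>B. w b * \<phi> b x)" for w x
  have r: "r w \<in> W" if "w \<in> W" for w
    unfolding r_def using fin B that by (intro diff lincomb)
  show ?case
  proof (cases "\<forall>w\<in>W. r w p = 0")
    case True
    then show ?thesis
      using B rep by (intro exI[of _ B] exI[of _ \<phi>]) (auto simp: r_def)
  next
    case False
    then obtain w0 where w0: "w0 \<in> W" "r w0 p \<noteq> 0" by blast
    \<comment> \<open>The normalised residual is a nodal function for \<open>p\<close>: it is 1
      there and 0 on \<open>S\<close>.\<close>
    define \<psi> where "\<psi> x = inverse (r w0 p) * r w0 x" for x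
    have \<psi>: "\<psi> \<in> W" "\<psi> p = 1" "\<And>x. x \<in> S \<Longrightarrow> \<psi> x = 0"
      using w0 rep[OF w0(1)] scale[OF r[OF w0(1)]] by (simp_all add: \<psi>_def[abs_def] r_def)
    \<comment> \<open>The old basis functions are corrected to vanish at \<open>p\<close>; their
      values on \<open>S\<close> do not change.\<close>
    define \<phi>' where "\<phi>' b x = (if b = p then \<psi> x else \<phi> b x + (- \<phi> b p) * \<psi> x)" for b x
    have "\<phi>' b \<in> W" if "b \<in> insert p B" for b
    proof (cases "b = p")
      case False
      with that have "(\<lambda>x. \<phi> b x + (- \<phi> b p) * \<psi> x) \<in> W"
        by (intro add_scale B \<psi>) auto
      with False show ?thesis by (simp add: \<phi>'_def[abs_def])
    qed (auto simp: \<phi>'_def[abs_def] \<psi>)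
    moreover have "w x = (\<Sum>b\<in>insert p B. w b * \<phi>' b x)" if "w \<in> W" "x \<in> insert p S" for w x
    proof -
      have "(\<Sum>b\<in>insert p B. w b * \<phi>' b x) = w p * \<psi> x + (\<Sum>b\<in>B. w b * \<phi>' b x)"
        using fin p by (simp add: \<phi>'_def)
      also have "(\<Sum>b\<in>B. w b * \<phi>' b x) = (\<Sum>b\<in>B. w b * (\<phi> b x + (- \<phi> b p) * \<psi> x))"
        using p by (intro sum.cong) (auto simp: \<phi>'_def)
      also have "\<dots> = (\<Sum>b\<in>B. w b * \<phi> b x) - (\<Sum>b\<in>B. w b * \<phi> b p) * \<psi> x"
        by (simp add: algebra_simps sum_subtractf sum_distrib_left)
      finally show ?thesis
        using that rep[OF that(1)] \<psi> by auto
    qed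
    ultimately show ?thesis
      using B(1) by (intro exI[of _ "insert p B"] exI[of _ \<phi>']) blast
  qed
qed

end

section \<open>The abstract exponential problem and its energy\<close>

text \<open>Points are indexed through \<open>p\<close>, so a vertex shared by several elements may
  occur repeatedly, each time with its own weight. The assumption \<open>determined\<close> makes
  control of these point values sufficient.\<close>

locale exponential_problem = function_space W for W :: "('a \<Rightarrow> real) set" +
  fixes a :: "('a \<Rightarrow> real) \<Rightarrow> ('a \<Rightarrow> real) \<Rightarrow> real"
    and I :: "'i set" and p :: "'i \<Rightarrow> 'a" and w g :: "'i \<Rightarrow> real"
  assumes finite_I: "finite I"
    and w_pos: "i \<in> I \<Longrightarrow> w i > 0"
    and g_pos: "i \<in> I \<Longrightarrow> g i > 0"
    and determined: "u \<in> W \<Longrightarrow> v \<in> W \<Longrightarrow> (\<And>i. i \<in> I \<Longrightarrow> u (p i) = v (p i)) \<Longrightarrow> u = v"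
    and a_sym: "a u v = a v u"
    and a_nonneg: "u \<in> W \<Longrightarrow> a u u \<ge> 0"
    and a_linear: "u \<in> W \<Longrightarrow> v \<in> W \<Longrightarrow> z \<in> W \<Longrightarrow> a (\<lambda>x. u x + s * v x) z = a u z + s * a v z"
begin

lemma a_zero: "z \<in> W \<Longrightarrow> a (\<lambda>_. 0) z = 0"
  using a_linear[OF zero zero, of z 1] by simp

lemma a_lincomb:
  assumes "finite B" "\<And>b. b \<in> B \<Longrightarrow> \<phi> b \<in> W" "z \<in> W"
  shows "a (\<lambda>x. \<Sum>b\<in>B. c b * \<phi> b x) z = (\<Sum>b\<in>B. c b * a (\<phi> b) z)"
  using assms
proof (induction B rule: finite_induct)
  case empty
  then show ?case by (simp add: a_zero)
next
  case (insert b B)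
  have "a (\<lambda>x. (\<Sum>b\<in>B. c b * \<phi> b x) + c b * \<phi> b x) z =
      a (\<lambda>x. \<Sum>b\<in>B. c b * \<phi> b x) z + c b * a (\<phi> b) z"
    using insert by (intro a_linear lincomb) auto
  with insert show ?case by (simp add: add.commute)
qed

definition energy :: "('a \<Rightarrow> real) \<Rightarrow> real" where
  "energy u = (\<Sum>i\<in>I. w i * (exp (u (p i)) - g i * u (p i))) + a u u / 2"

text \<open>The form is nonnegative and all summands are bounded below, so one large point value
  already pushes the energy above its value at zero.\<close>

lemma energy_coercive:
  "\<exists>R\<ge>0. \<forall>u\<in>W. \<forall>i\<in>I. \<bar>u (p i)\<bar> > R \<longrightarrow> energy u > energy (\<lambda>_. 0)"
proof -
  have "\<exists>C. \<forall>y. g i / 2 * \<bar>y\<bar> - C \<le> exp y - g i * y" if "i \<in> I" for i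
    using exp_minus_linear_coercive[OF g_pos[OF that]] by metis
  then obtain C where C: "\<And>i y. i \<in> I \<Longrightarrow> g i / 2 * \<bar>y\<bar> - C i \<le> exp y - g i * y"
    by metis
  define D where "D = (\<Sum>i\<in>I. w i * C i)"
  have lower: "w i * (g i / 2 * \<bar>u (p i)\<bar>) - D \<le> energy u" if "u \<in> W" "i \<in> I" for u i
  proof -
    have "w i * (g i / 2 * \<bar>u (p i)\<bar>) \<le> (\<Sum>i\<in>I. w i * (g i / 2 * \<bar>u (p i)\<bar>))"
      using that finite_I w_pos g_pos by (intro member_le_sum) (auto intro!: mult_nonneg_nonneg simp: less_imp_le)
    also have "\<dots> - D = (\<Sum>i\<in>I. w i * (g i / 2 * \<bar>u (p i)\<bar> - C i))"
      by (simp add: D_def right_diff_distrib sum_subtractf)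
    also have "\<dots> \<le> (\<Sum>i\<in>I. w i * (exp (u (p i)) - g i * u (p i)))"
      using C w_pos by (intro sum_mono mult_left_mono) (auto simp: less_imp_le)
    also have "\<dots> \<le> energy u"
      using a_nonneg[OF that(1)] by (simp add: energy_def)
    finally show ?thesis by simp
  qed
  define E where "E = \<bar>energy (\<lambda>_. 0) + D\<bar>"
  \<comment> \<open>Each term is the threshold for one index. Their sum dominates all of them, and
    it is 0 if there are no indices.\<close>
  define R where "R = (\<Sum>i\<in>I. E / (w i * (g i / 2)))"
  have nonneg: "E / (w i * (g i / 2)) \<ge> 0" if "i \<in> I" for i
    using w_pos[OF that] g_pos[OF that] by (simp add: E_def)
  show ?thesis
  proof (intro exI[of _ R] conjI ballI impI)
    show "R \<ge> 0" unfolding R_def by (intro sum_nonneg nonneg)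
    fix u i assume u: "u \<in> W" "i \<in> I" "\<bar>u (p i)\<bar> > R"
    have "E / (w i * (g i / 2)) \<le> R"
      unfolding R_def using u finite_I nonneg by (intro member_le_sum) auto
    with u have "E / (w i * (g i / 2)) < \<bar>u (p i)\<bar>" by linarith
    then have "E < w i * (g i / 2 * \<bar>u (p i)\<bar>)"
      using w_pos[OF u(2)] g_pos[OF u(2)] by (simp add: field_simps)
    with lower[OF u(1,2)] show "energy u > energy (\<lambda>_. 0)"
      unfolding E_def by linarith
  qed
qed

text \<open>In coordinates given by point values, coercivity confines the search to a compact cube,
  on which the continuous energy attains its infimum.\<close>

lemma energy_minimum: "\<exists>u\<in>W. \<forall>v\<in>W. energy u \<le> energy v"
proof -
  obtain B \<phi> where B: "B \<subseteq> p ` I" and \<phi>: "\<And>b. b \<in> B \<Longrightarrow> \<phi> b \<in> W"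
    and rep: "\<And>u x. u \<in> W \<Longrightarrow> x \<in> p ` I \<Longrightarrow> u x = (\<Sum>b\<in>B. u b * \<phi> b x)"
    using interpolatory_basis[of "p ` I"] finite_I by blast
  have fin: "finite B" using B finite_I finite_surj by blast
  define U where "U c x = (\<Sum>b\<in>B. c b * \<phi> b x)" for c x
  have U: "U c \<in> W" for c unfolding U_def by (intro lincomb fin \<phi>)
  have U_eq: "U u = u" if "u \<in> W" for u
    by (rule determined) (use that U rep in \<open>auto simp: U_def\<close>)
  \<comment> \<open>Written as a polynomial in the coefficients, the form is visibly continuous in
    them.\<close>
  have aU: "a (U c) (U c) = (\<Sum>b\<in>B. c b * (\<Sum>b'\<in>B. c b' * a (\<phi> b) (\<phi> b')))" for c
  proof -
    have "a (U c) (U c) = (\<Sum>b\<in>B. c b * a (\<phi> b) (U c))"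
      by (subst (1) U_def[abs_def]) (intro a_lincomb fin \<phi> U)
    also have "\<dots> = (\<Sum>b\<in>B. c b * (\<Sum>b'\<in>B. c b' * a (\<phi> b) (\<phi> b')))"
    proof (intro sum.cong refl arg_cong2[where f = "(*)"])
      fix b assume "b \<in> B"
      have "a (\<phi> b) (U c) = a (U c) (\<phi> b)" by (rule a_sym)
      also have "\<dots> = (\<Sum>b'\<in>B. c b' * a (\<phi> b') (\<phi> b))"
        unfolding U_def by (rule a_lincomb) (use fin \<phi> \<open>b \<in> B\<close> in auto)
      finally show "a (\<phi> b) (U c) = (\<Sum>b'\<in>B. c b' * a (\<phi> b) (\<phi> b'))"
        by (simp add: a_sym)
    qed
    finally show ?thesis .
  qed
  have cont: "continuous_on X (\<lambda>c. energy (U c))" for X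
    unfolding energy_def aU unfolding U_def
    by (intro continuous_intros continuous_on_subset[OF continuous_on_product_coordinates]) auto
  obtain R where R: "R \<ge> 0" "\<And>u i. u \<in> W \<Longrightarrow> i \<in> I \<Longrightarrow> \<bar>u (p i)\<bar> > R \<Longrightarrow> energy u > energy (\<lambda>_. 0)"
    using energy_coercive by blast
  \<comment> \<open>Coefficients are total functions; pinning those outside \<open>B\<close> to 0
    makes the set a product of compact sets.\<close>
  define X where "X = PiE UNIV (\<lambda>b. if b \<in> B then {-R..R} else {0})"
  have "compactin (product_topology (\<lambda>_. euclidean) UNIV) X"
    unfolding X_def by (auto simp: compactin_PiE)
  then have "compact X"
    by (simp add: euclidean_product_topology flip: compactin_euclidean_iff)
  \<comment> \<open>The zero vector shows that the cube is nonempty and is the competitor for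
    functions outside it.\<close>
  moreover have zX: "(\<lambda>_. 0) \<in> X"
    using R(1) by (auto simp: X_def)
  ultimately obtain c where c: "c \<in> X" "\<And>c'. c' \<in> X \<Longrightarrow> energy (U c) \<le> energy (U c')"
    using continuous_attains_inf[OF _ _ cont, of X] by blast
  have "energy (U c) \<le> energy v" if v: "v \<in> W" for v
  proof (cases "\<forall>b\<in>B. \<bar>v b\<bar> \<le> R")
    case True
    let ?c = "\<lambda>b. if b \<in> B then v b else 0"
    have "?c \<in> X" using True R(1) by (force simp: X_def abs_le_iff)
    from c(2)[OF this] have "energy (U c) \<le> energy (U ?c)" .
    also have "U ?c = U v" by (auto simp: U_def)
    finally show ?thesis using U_eq[OF v] by simp
  next
    case False
    with B obtain i where "i \<in> I" "\<bar>v (p i)\<bar> > R" by force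
    with R(2)[OF v] have "energy (\<lambda>_. 0) < energy v" by blast
    with c(2)[OF zX] U_eq[OF zero] show ?thesis by simp
  qed
  with U show ?thesis by blast
qed

lemma energy_derivative:
  assumes u: "u \<in> W" and v: "v \<in> W"
  shows "((\<lambda>t. energy (\<lambda>x. u x + t * v x)) has_field_derivative
    (\<Sum>i\<in>I. w i * (exp (u (p i)) - g i) * v (p i)) + a u v) (at 0)"
proof -
  have "a (\<lambda>x. u x + t * v x) (\<lambda>x. u x + t * v x) = a u u + 2 * t * a u v + t\<^sup>2 * a v v" for t
  proof -
    have uv: "(\<lambda>x. u x + t * v x) \<in> W" using u v by (rule add_scale)
    \<comment> \<open>Linearity is assumed in the first argument only; symmetry transfers it to the
      second.\<close>
    have "a (\<lambda>x. u x + t * v x) (\<lambda>x. u x + t * v x) =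
        a (\<lambda>x. u x + t * v x) u + t * a (\<lambda>x. u x + t * v x) v"
      using a_linear[OF u v uv, of t] a_sym[of u] a_sym[of v] by metis
    then show ?thesis
      using a_linear[OF u v u] a_linear[OF u v v] a_sym[of v u]
      by (simp add: algebra_simps power2_eq_square)
  qed
  then have "energy (\<lambda>x. u x + t * v x) =
      (\<Sum>i\<in>I. w i * (exp (u (p i) + t * v (p i)) - g i * (u (p i) + t * v (p i))))
      + (a u u + 2 * t * a u v + t\<^sup>2 * a v v) / 2" for t
    by (simp add: energy_def)
  then show ?thesis
    by (auto intro!: derivative_eq_intros sum.cong simp: algebra_simps)
qed

text \<open>The equation tested with \<open>v\<close> says that the energy is stationary at its
  minimiser in the direction \<open>v\<close>.\<close>

lemma solution_exists:
  "\<exists>u\<in>W. \<forall>v\<in>W. (\<Sum>i\<in>I. w i * (exp (u (p i)) - g i) * v (p i)) + a u v = 0"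
proof -
  obtain u where u: "u \<in> W" "\<And>v. v \<in> W \<Longrightarrow> energy u \<le> energy v"
    using energy_minimum by blast
  have "(\<Sum>i\<in>I. w i * (exp (u (p i)) - g i) * v (p i)) + a u v = 0" if v: "v \<in> W" for v
    by (rule DERIV_local_min[OF energy_derivative[OF u(1) v], of 1])
      (use u v add_scale in auto)
  with u show ?thesis by blast
qed

lemma solution_unique:
  assumes u: "u \<in> W" "\<And>z. z \<in> W \<Longrightarrow> (\<Sum>i\<in>I. w i * (exp (u (p i)) - g i) * z (p i)) + a u z = 0"
    and v: "v \<in> W" "\<And>z. z \<in> W \<Longrightarrow> (\<Sum>i\<in>I. w i * (exp (v (p i)) - g i) * z (p i)) + a v z = 0"
  shows "u = v"
proof -
  define e where "e x = u x - v x" for x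
  have e: "e \<in> W" using diff[OF u(1) v(1)] by (simp add: e_def[abs_def])
  have "e = (\<lambda>x. u x + (-1) * v x)" by (simp add: e_def fun_eq_iff)
  then have "a e e = a u e - a v e"
    using a_linear[OF u(1) v(1) e, of "-1"] by simp
  \<comment> \<open>Subtracting the equations cancels the data \<open>g\<close>.\<close>
  then have "(\<Sum>i\<in>I. w i * ((exp (u (p i)) - exp (v (p i))) * e (p i))) + a e e =
      ((\<Sum>i\<in>I. w i * (exp (u (p i)) - g i) * e (p i)) + a u e) -
      ((\<Sum>i\<in>I. w i * (exp (v (p i)) - g i) * e (p i)) + a v e)"
    by (simp add: algebra_simps sum_subtractf)
  also have "\<dots> = 0" using u(2)[OF e] v(2)[OF e] by simp
  finally have "(\<Sum>i\<in>I. w i * ((exp (u (p i)) - exp (v (p i))) * e (p i))) \<le> 0"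
    using a_nonneg[OF e] by linarith
  moreover have nonneg: "w i * ((exp (u (p i)) - exp (v (p i))) * e (p i)) \<ge> 0" if "i \<in> I" for i
  proof -
    have "(exp (u (p i)) - exp (v (p i))) * e (p i) \<ge> 0"
      by (cases "v (p i) \<le> u (p i)") (simp_all add: e_def mult_nonpos_nonpos)
    then show ?thesis using w_pos[OF that] by simp
  qed
  ultimately have "(\<Sum>i\<in>I. w i * ((exp (u (p i)) - exp (v (p i))) * e (p i))) = 0"
    by (intro antisym sum_nonneg) auto
  then have "\<forall>i\<in>I. w i * ((exp (u (p i)) - exp (v (p i))) * e (p i)) = 0"
    by (subst (asm) sum_nonneg_eq_0_iff[OF finite_I nonneg])
  then have "u (p i) = v (p i)" if "i \<in> I" for i
    using w_pos[OF that] that by (force simp: e_def)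
  then show ?thesis by (rule determined[OF u(1) v(1)])
qed

theorem unique_solution:
  "\<exists>!u. u \<in> W \<and> (\<forall>v\<in>W. (\<Sum>i\<in>I. w i * (exp (u (p i)) - g i) * v (p i)) + a u v = 0)"
proof -
  obtain u where "u \<in> W" "\<forall>v\<in>W. (\<Sum>i\<in>I. w i * (exp (u (p i)) - g i) * v (p i)) + a u v = 0"
    using solution_exists by blast
  then show ?thesis
    using solution_unique by (intro ex1I[of _ u]) auto
qed

end

section \<open>Finite element functions on simplicial triangulations\<close>

text \<open>The affinely independent points spanning a simplex are exactly its extreme
  points.\<close>

lemma vertices_simplex:
  fixes K :: "'a::euclidean_space set"
  assumes "n simplex K"
  shows "finite (vertices K)" "K = convex hull vertices K"
proof -
  obtain C where C: "\<not> affine_dependent C" "K = convex hull C"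
    using assms by (auto simp: simplex_def)
  then have "vertices K = C"
    by (simp add: vertices_def extreme_point_of_convex_hull_affine_independent)
  with C show "finite (vertices K)" "K = convex hull vertices K"
    using aff_independent_finite by simp_all
qed

lemma simplex_compact:
  fixes K :: "'a::euclidean_space set"
  shows "n simplex K \<Longrightarrow> compact K"
  using vertices_simplex by (metis finite_imp_compact_convex_hull)

text \<open>The hull of d + 1 affinely independent points has nonempty interior, and a convex set
  with interior points is not negligible. This makes the lumping weights positive.\<close>

lemma simplex_measure_pos:
  fixes K :: "'a::euclidean_space set"
  assumes "int DIM('a) simplex K"
  shows "measure lebesgue K > 0"
proof -
  obtain C where C: "\<not> affine_dependent C" "int (card C) = int DIM('a) + 1" "K = convex hull C"
    using assms by (auto simp: simplex_def)
  then have "card C = Suc DIM('a)" by linarith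
  from interior_convex_hull_eq_empty[OF this] C have "interior K \<noteq> {}" by simp
  then have "\<not> negligible K"
    using C(3) by (simp add: negligible_convex_interior)
  moreover have "K \<in> lmeasurable"
    using simplex_compact[OF assms] by (rule lmeasurable_compact)
  ultimately show ?thesis
    by (simp add: negligible_iff_measure zero_less_measure_iff)
qed

section \<open>Affine functions on elements and the finite element space\<close>

lemma P1_on_add_scale:
  assumes "P1_on K u" "P1_on K v"
  shows "P1_on K (\<lambda>x. u x + s * v x)"
proof -
  obtain c a c' a' where "\<forall>x\<in>K. u x = c + a \<bullet> x" "\<forall>x\<in>K. v x = c' + a' \<bullet> x"
    using assms by (auto simp: P1_on_def)
  then have "\<forall>x\<in>K. u x + s * v x = (c + s * c') + (a + s *\<^sub>R a') \<bullet> x"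
    by (simp add: algebra_simps)
  then show ?thesis unfolding P1_on_def by blast
qed

lemma P1_on_zero: "P1_on K (\<lambda>_. 0)"
  unfolding P1_on_def by (intro exI[of _ 0]) simp

text \<open>The zero set of an affine function is convex, so a difference vanishing on
  \<open>S\<close> vanishes on its hull.\<close>

lemma P1_on_convex_hull_eqI:
  assumes "P1_on (convex hull S) u" "P1_on (convex hull S) v"
    and eq: "\<And>x. x \<in> S \<Longrightarrow> u x = v x" and x: "x \<in> convex hull S"
  shows "u x = v x"
proof -
  obtain c a where d: "\<forall>x\<in>convex hull S. u x + (-1) * v x = c + a \<bullet> x"
    using P1_on_add_scale[OF assms(1,2), of "-1"] by (auto simp: P1_on_def)
  have "convex hull S \<subseteq> {x. a \<bullet> x = - c}"
  proof (rule hull_minimal)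
    show "S \<subseteq> {x. a \<bullet> x = - c}"
      using d eq hull_subset[of S convex] by force
  qed (rule convex_hyperplane)
  with d x show ?thesis by force
qed

lemma bounded_polyhedral_domain_bounded_open:
  assumes "bounded_polyhedral_domain \<Omega>"
  shows "bounded_open_set \<Omega>"
proof
  show "open \<Omega>" using assms by (simp add: bounded_polyhedral_domain_def)
  obtain F where F: "finite F" "\<forall>P\<in>F. polytope P" "\<Omega> = interior (\<Union>F)"
    using assms by (auto simp: bounded_polyhedral_domain_def)
  then have "bounded (\<Union>F)" by (auto intro: polytope_imp_bounded)
  with F(3) show "bounded \<Omega>" using bounded_subset interior_subset by blast
qed

text \<open>The function is continuous on each compact element, and finitely many elements cover
  \<Omega>. This bounds the exponential coefficient of the stiffness form.\<close>

lemma fe_space_bounded: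
  assumes T: "conforming_triangulation \<T> \<Omega>" and u: "u \<in> fe_space \<Omega> \<T>"
  obtains C where "\<And>x. x \<in> \<Omega> \<Longrightarrow> \<bar>u x\<bar> \<le> C"
proof -
  have "bounded (u ` K)" if "K \<in> \<T>" for K
  proof -
    obtain c a where "\<forall>x\<in>K. u x = c + a \<bullet> x"
      using u \<open>K \<in> \<T>\<close> unfolding fe_space_def P1_on_def by blast
    then have "continuous_on K u \<longleftrightarrow> continuous_on K (\<lambda>x. c + a \<bullet> x)"
      by (intro continuous_on_cong) auto
    then have "continuous_on K u" by (auto intro!: continuous_intros)
    moreover have "compact K"
      using T that simplex_compact by (auto simp: conforming_triangulation_def)
    ultimately show ?thesis
      by (intro compact_imp_bounded compact_continuous_image)
  qed
  moreover have "finite \<T>"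
    using T by (simp add: conforming_triangulation_def triangulation_def)
  ultimately have "bounded (u ` \<Union>\<T>)"
    by (auto simp: image_Union)
  then have "bounded (u ` closure \<Omega>)"
    using T by (simp add: conforming_triangulation_def)
  then show thesis
    using closure_subset[of \<Omega>] that by (force simp: bounded_iff)
qed

lemma fe_space_function_space:
  assumes "bounded_polyhedral_domain \<Omega>"
  shows "function_space (fe_space \<Omega> \<T>)"
proof -
  interpret bounded_open_set \<Omega>
    using assms by (rule bounded_polyhedral_domain_bounded_open)
  show ?thesis
    by unfold_locales (auto simp: fe_space_def H1_zero H1_add_scale P1_on_zero P1_on_add_scale)
qed

text \<open>Vertex values determine the affine function on each element, the elements cover the
  closure, and outside it both functions are normalised to 0.\<close>

lemma fe_space_eqI:
  assumes T: "conforming_triangulation \<T> \<Omega>"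
    and u: "u \<in> fe_space \<Omega> \<T>" and v: "v \<in> fe_space \<Omega> \<T>"
    and eq: "\<And>K x. K \<in> \<T> \<Longrightarrow> x \<in> vertices K \<Longrightarrow> u x = v x"
  shows "u = v"
proof
  fix x
  show "u x = v x"
  proof (cases "x \<in> closure \<Omega>")
    case True
    then obtain K where K: "K \<in> \<T>" "x \<in> K"
      using T by (auto simp: conforming_triangulation_def)
    have hull: "K = convex hull vertices K"
      using T K(1) vertices_simplex(2) by (auto simp: conforming_triangulation_def)
    have "P1_on K u" "P1_on K v"
      using u v K(1) by (simp_all add: fe_space_def)
    then show ?thesis
      using P1_on_convex_hull_eqI[of "vertices K" u v x] eq[OF K(1)] hull K(2) by simp
  qed (use u v in \<open>simp add: fe_space_def\<close>)
qed

lemma fe_space_exp_coefficient: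
  assumes T: "conforming_triangulation \<T> \<Omega>" and u: "u \<in> fe_space \<Omega> \<T>"
    and \<Omega>: "\<Omega> \<in> sets lebesgue" and m: "m \<ge> 0"
  shows "set_borel_measurable lebesgue \<Omega> (\<lambda>x. m * exp (m * u x))"
    and "\<exists>C. \<forall>x\<in>\<Omega>. \<bar>m * exp (m * u x)\<bar> \<le> C"
proof -
  have u': "(\<lambda>x. indicator \<Omega> x *\<^sub>R u x) \<in> borel_measurable lebesgue"
    using u by (auto simp: fe_space_def H1_def square_integrable_on_def set_borel_measurable_def)
  \<comment> \<open>Truncating \<open>u\<close> inside the exponential changes nothing on \<Omega>
    and gives a function measurable on the whole space.\<close>
  have "(\<lambda>x. indicator \<Omega> x *\<^sub>R (m * exp (m * (indicator \<Omega> x *\<^sub>R u x)))) \<in> borel_measurable lebesgue"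
    using \<Omega> by (intro borel_measurable_scaleR borel_measurable_indicator borel_measurable_times
        borel_measurable_const borel_measurable_exp[THEN measurable_compose[rotated]] u')
  then show "set_borel_measurable lebesgue \<Omega> (\<lambda>x. m * exp (m * u x))"
    unfolding set_borel_measurable_def
    by (rule measurable_cong[THEN iffD1, rotated]) (auto simp: indicator_def)
  obtain C where "\<And>x. x \<in> \<Omega> \<Longrightarrow> \<bar>u x\<bar> \<le> C"
    using fe_space_bounded[OF T u] by blast
  then have "\<bar>m * exp (m * u x)\<bar> \<le> m * exp (m * C)" if "x \<in> \<Omega>" for x
    using m that by (auto simp: abs_mult abs_le_iff intro!: mult_left_mono)
  then show "\<exists>C. \<forall>x\<in>\<Omega>. \<bar>m * exp (m * u x)\<bar> \<le> C" by blast
qed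

text \<open>Pairs of an element and one of its vertices serve as the single index set of the
  abstract problem.\<close>

lemma lumped_mass_alt:
  assumes "conforming_triangulation \<T> \<Omega>"
  shows "lumped_mass \<T> \<alpha> (\<beta> :: 'a::euclidean_space \<Rightarrow> real) = (\<Sum>i\<in>Sigma \<T> vertices.
    measure lebesgue (fst i) / (real DIM('a) + 1) * \<alpha> (snd i) * \<beta> (snd i))"
proof -
  have "finite \<T>" "\<forall>K\<in>\<T>. finite (vertices K)"
    using assms vertices_simplex(1)
    unfolding conforming_triangulation_def triangulation_def by blast+
  from sum.Sigma[OF this] show ?thesis
    by (simp add: lumped_mass_def case_prod_beta)
qed

section \<open>The lumped scheme as an instance of the abstract problem\<close>

theorem theorem2p2:
  fixes \<Omega> :: "(real ^ 'd) set"
    and \<Omega>\<^sub>h :: "(real ^ 'd) set set"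
    and m \<Delta>t :: real
    and u_prev :: "real ^ 'd \<Rightarrow> real"
  assumes "CARD('d) \<in> {1, 2, 3}"
    and "bounded_polyhedral_domain \<Omega>"
    and "conforming_triangulation \<Omega>\<^sub>h \<Omega>"
    and "m \<ge> 1"
    and "\<Delta>t > 0"
    and "u_prev \<in> fe_space \<Omega> \<Omega>\<^sub>h"
  shows "\<exists>!u. u \<in> fe_space \<Omega> \<Omega>\<^sub>h \<and>
    (\<forall>v \<in> fe_space \<Omega> \<Omega>\<^sub>h.
       lumped_mass \<Omega>\<^sub>h (\<lambda>x. (exp (u x) - exp (u_prev x)) / \<Delta>t) v
       + stiffness \<Omega> (\<lambda>x. m * exp (m * u_prev x)) u v = 0)"
proof -
  interpret bounded_open_set \<Omega>
    using assms(2) by (rule bounded_polyhedral_domain_bounded_open)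
  interpret function_space "fe_space \<Omega> \<Omega>\<^sub>h"
    using assms(2) by (rule fe_space_function_space)
  let ?\<gamma> = "\<lambda>x. m * exp (m * u_prev x)"
  let ?I = "Sigma \<Omega>\<^sub>h vertices"
  \<comment> \<open>The time step is absorbed into the weights, so that the mass term has the
    abstract form.\<close>
  let ?w = "\<lambda>i. measure lebesgue (fst i :: (real ^ 'd) set) / (real DIM(real ^ 'd) + 1) / \<Delta>t"
  have m: "m \<ge> 0" using assms(4) by simp
  note \<gamma> = fe_space_exp_coefficient[OF assms(3,6) sets_\<Omega> m]
  obtain C where C: "\<And>x. x \<in> \<Omega> \<Longrightarrow> \<bar>?\<gamma> x\<bar> \<le> C"
    using \<gamma>(2) by blast
  have simplices: "finite \<Omega>\<^sub>h" "\<And>K. K \<in> \<Omega>\<^sub>h \<Longrightarrow> int DIM(real ^ 'd) simplex K"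
    using assms(3) by (auto simp: conforming_triangulation_def triangulation_def)
  interpret exponential_problem "fe_space \<Omega> \<Omega>\<^sub>h" "stiffness \<Omega> ?\<gamma>" ?I snd ?w "\<lambda>i. exp (u_prev (snd i))"
  proof
    show "finite ?I"
      using simplices vertices_simplex(1) by blast
    show "?w i > 0" if "i \<in> ?I" for i
      using that simplices(2) simplex_measure_pos assms(5) by (intro divide_pos_pos) fastforce+
    show "u = v" if "u \<in> fe_space \<Omega> \<Omega>\<^sub>h" "v \<in> fe_space \<Omega> \<Omega>\<^sub>h"
      "\<And>i. i \<in> ?I \<Longrightarrow> u (snd i) = v (snd i)" for u v
      using that(3) by (intro fe_space_eqI[OF assms(3) that(1,2)]) fastforce
    show "stiffness \<Omega> ?\<gamma> u v = stiffness \<Omega> ?\<gamma> v u" for u v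
      by (rule stiffness_commute)
    show "stiffness \<Omega> ?\<gamma> u u \<ge> 0" for u
      using m by (intro stiffness_nonneg) simp
    show "stiffness \<Omega> ?\<gamma> (\<lambda>x. u x + s * v x) z = stiffness \<Omega> ?\<gamma> u z + s * stiffness \<Omega> ?\<gamma> v z"
      if "u \<in> fe_space \<Omega> \<Omega>\<^sub>h" "v \<in> fe_space \<Omega> \<Omega>\<^sub>h" "z \<in> fe_space \<Omega> \<Omega>\<^sub>h" for u v z s
      using that by (intro stiffness_linear[OF _ _ _ \<gamma>(1) C]) (auto simp: fe_space_def)
  qed simp
  have "lumped_mass \<Omega>\<^sub>h (\<lambda>x. (exp (u x) - exp (u_prev x)) / \<Delta>t) v =
      (\<Sum>i\<in>?I. ?w i * (exp (u (snd i)) - exp (u_prev (snd i))) * v (snd i))" for u v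
    unfolding lumped_mass_alt[OF assms(3)] by (intro sum.cong) auto
  with unique_solution show ?thesis by simp
qed

end
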